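(* Let $1/2<\rho<1$ and consider the iterated function system on $[0,1]$ consisting of $f_1(x)=\rho x$ and $f_2(x)=\rho x+(1-\rho)$. If there exists a reduced banned word $\alpha=\alpha_1\cdots\alpha_n$ such that $f_\alpha(1)=\rho$, that is, $\rho^n+(1-\rho)\sum_{i=1}^n(\alpha_i-1)\rho^{i-1}=\rho$, then the iterated function system is of finite type, i.e. $\overline{\Sigma}_{\mathrm{top}}$ is a shift space of finite type.
   Context: $\mathbb{N}=\{1,2,\dots\}$. Let $\Sigma=\{1,2\}^{\mathbb{N}}$ with the product topology and the lexicographic order induced by $1<2$. For a finite word $\alpha=\alpha_1\cdots\alpha_n$ over $\{1,2\}$ write $f_\alpha=f_{\alpha_1}\circ\cdots\circ f_{\alpha_n}$ and $|\alpha|=n$. The address map $\pi:\Sigma\to[0,1]$ is $\pi(\sigma)=\lim_{k\to\infty}f_{\sigma_1}\circ\cdots\circ f_{\sigma_k}(x)$ (independent of $x$); its image, the attractor, is $[0,1]$. For $x\in[0,1]$ the top address of $x$ is $\tau(x)=\min\pi^{-1}(x)$ (lexicographic minimum), $\Sigma_{\mathrm{top}}=\tau([0,1])$, and $\overline{\Sigma}_{\mathrm{top}}$ is its closure in $\Sigma$. A finite word is banned if it does not occur as a block of consecutive letters in any element of $\overline{\Sigma}_{\mathrm{top}}$; a banned word is reduced (a "reduced banned word") if none of its proper subwords (blocks of consecutive letters) is banned. A shift space of finite type is a set of the form $\{x\in\{1,2\}^{\mathbb{N}}: x \text{ contains no word of } B\}$ for some finite set $B$ of finite words. *)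

theory Defs
  imports "HOL-Analysis.Analysis" "HOL-Library.Fun_Lexorder" "HOL-Library.Sublist"
begin

text \<open>
  Sequences of letters are indexed from 0: the i-th letter of a sequence (i = 1, 2, ...)
  is its value at i - 1.
\<close>

definition seq_topology :: "(nat \<Rightarrow> nat) topology" where
  "seq_topology = product_topology (\<lambda>_. discrete_topology {1, 2}) UNIV"

definition full_shift :: "(nat \<Rightarrow> nat) set" where
  "full_shift = {\<sigma>. \<forall>i. \<sigma> i \<in> {1, 2}}"

lemma topspace_seq_topology: "topspace seq_topology = full_shift"
  by (auto simp: seq_topology_def full_shift_def PiE_iff)

definition words :: "nat list set" where
  "words = lists {1, 2}"

text \<open>Only the letters 1 and 2 are meaningful as the second argument.\<close>
definition ifs_map :: "real \<Rightarrow> nat \<Rightarrow> real \<Rightarrow> real" where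
  "ifs_map \<rho> a x = (if a = 1 then \<rho> * x else \<rho> * x + (1 - \<rho>))"

definition word_map :: "real \<Rightarrow> nat list \<Rightarrow> real \<Rightarrow> real" where
  "word_map \<rho> w = foldr (\<lambda>a g. ifs_map \<rho> a \<circ> g) w id"

lemma word_map_Nil [simp]: "word_map \<rho> [] x = x"
  by (simp add: word_map_def)

lemma word_map_Cons [simp]: "word_map \<rho> (a # w) x = ifs_map \<rho> a (word_map \<rho> w x)"
  by (simp add: word_map_def)

lemma word_map_one:
  assumes "w \<in> words"
  shows "word_map \<rho> w 1
    = \<rho> ^ length w + (1 - \<rho>) * (\<Sum>i<length w. (real (w ! i) - 1) * \<rho> ^ i)"
  using assms
proof (induction w)
  case (Cons a w)
  have w: "w \<in> words" and a: "a = 1 \<or> a = 2"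
    using Cons.prems by (auto simp: words_def)
  have "(\<Sum>i<length (a # w). (real ((a # w) ! i) - 1) * \<rho> ^ i)
      = (real a - 1) + \<rho> * (\<Sum>i<length w. (real (w ! i) - 1) * \<rho> ^ i)"
    by (simp add: sum.lessThan_Suc_shift sum_distrib_left mult_ac del: sum.lessThan_Suc)
  moreover have "word_map \<rho> (a # w) 1 = \<rho> * word_map \<rho> w 1 + (1 - \<rho>) * (real a - 1)"
    using a by (auto simp: ifs_map_def)
  ultimately show ?case
    by (simp only: Cons.IH[OF w]) (simp add: distrib_left)
qed simp

text \<open>
  The limit does not depend on the point at which the maps are evaluated
  (\<open>address_map_tendsto\<close> below); the definition uses 0.
\<close>
definition address_map :: "real \<Rightarrow> (nat \<Rightarrow> nat) \<Rightarrow> real" where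
  "address_map \<rho> \<sigma> = lim (\<lambda>k. word_map \<rho> (map \<sigma> [0..<k]) 0)"

lemma word_map_diff: "word_map \<rho> w x - word_map \<rho> w y = \<rho> ^ length w * (x - y)"
proof (induction w)
  case (Cons a w)
  have "word_map \<rho> (a # w) x - word_map \<rho> (a # w) y
      = \<rho> * (word_map \<rho> w x - word_map \<rho> w y)"
    by (simp add: ifs_map_def algebra_simps)
  then show ?case by (simp add: Cons.IH)
qed simp

lemma word_map_append: "word_map \<rho> (v @ w) x = word_map \<rho> v (word_map \<rho> w x)"
  by (induction v) auto

lemma address_map_tendsto:
  assumes "0 < \<rho>" "\<rho> < 1"
  shows "(\<lambda>k. word_map \<rho> (map \<sigma> [0..<k]) x) \<longlonglongrightarrow> address_map \<rho> \<sigma>"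
proof -
  let ?g = "\<lambda>k x. word_map \<rho> (map \<sigma> [0..<k]) x"
  have step: "?g (Suc k) 0 - ?g k 0 = \<rho> ^ k * ifs_map \<rho> (\<sigma> k) 0" for k
    using word_map_diff[of \<rho> "map \<sigma> [0..<k]" "ifs_map \<rho> (\<sigma> k) 0" 0]
    by (simp add: word_map_append)
  have "norm (?g (Suc k) 0 - ?g k 0) \<le> \<rho> ^ k" for k
    unfolding step using assms by (auto simp: ifs_map_def abs_mult mult_left_le)
  then have "summable (\<lambda>k. ?g (Suc k) 0 - ?g k 0)"
    using assms by (intro summable_comparison_test'[OF summable_geometric[of \<rho>]]) auto
  then have "convergent (\<lambda>k. ?g k 0)"
    unfolding summable_iff_convergent sum_lessThan_telescope[of "\<lambda>k. ?g k 0"] by simp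
  then have lim0: "(\<lambda>k. ?g k 0) \<longlonglongrightarrow> address_map \<rho> \<sigma>"
    unfolding address_map_def by (simp add: convergent_LIMSEQ_iff)
  have "(\<lambda>k. \<rho> ^ k * x) \<longlonglongrightarrow> 0"
    using assms by (auto intro!: tendsto_eq_intros LIMSEQ_realpow_zero)
  from tendsto_add[OF lim0 this] show ?thesis
    using word_map_diff[of \<rho> "map \<sigma> [0..<k]" x 0 for k]
    by (simp add: algebra_simps)
qed

text \<open>
  \<^const>\<open>less_fun\<close> from \<^theory>\<open>HOL-Library.Fun_Lexorder\<close> is the strict lexicographic order on
  sequences.
\<close>
definition top_address :: "real \<Rightarrow> real \<Rightarrow> nat \<Rightarrow> nat" where
  "top_address \<rho> x = (THE \<sigma>. \<sigma> \<in> full_shift \<and> address_map \<rho> \<sigma> = x \<and>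
     (\<forall>\<upsilon>\<in>full_shift. address_map \<rho> \<upsilon> = x \<longrightarrow> \<sigma> = \<upsilon> \<or> less_fun \<sigma> \<upsilon>))"

definition top_addresses :: "real \<Rightarrow> (nat \<Rightarrow> nat) set" where
  "top_addresses \<rho> = top_address \<rho> ` {0..1}"

definition top_closure :: "real \<Rightarrow> (nat \<Rightarrow> nat) set" where
  "top_closure \<rho> = seq_topology closure_of top_addresses \<rho>"

definition occurs_in :: "nat list \<Rightarrow> (nat \<Rightarrow> nat) \<Rightarrow> bool" where
  "occurs_in w \<sigma> \<longleftrightarrow> (\<exists>k. map \<sigma> [k..<k + length w] = w)"

definition banned :: "real \<Rightarrow> nat list \<Rightarrow> bool" where
  "banned \<rho> w \<longleftrightarrow> w \<in> words \<and> \<not> (\<exists>\<sigma>\<in>top_closure \<rho>. occurs_in w \<sigma>)"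

definition reduced_banned :: "real \<Rightarrow> nat list \<Rightarrow> bool" where
  "reduced_banned \<rho> w \<longleftrightarrow> banned \<rho> w \<and> (\<forall>v. strict_sublist v w \<longrightarrow> \<not> banned \<rho> v)"

definition shift_of_finite_type :: "(nat \<Rightarrow> nat) set \<Rightarrow> bool" where
  "shift_of_finite_type S \<longleftrightarrow>
     (\<exists>B. finite B \<and> B \<subseteq> words \<and> S = {\<sigma> \<in> full_shift. \<forall>w\<in>B. \<not> occurs_in w \<sigma>})"

definition ifs_of_finite_type :: "real \<Rightarrow> bool" where
  "ifs_of_finite_type \<rho> \<longleftrightarrow> shift_of_finite_type (top_closure \<rho>)"

end

theory Submission
  imports Defs
begin

text \<open>
  The lexicographically smallest address of a point is computed greedily: the letter 1 is chosen
  whenever the current point lies in the image \<open>[0, \<rho>]\<close> of \<open>f\<^sub>1\<close>. Hence the top addresses are exactly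
  the sequences each of whose tails starting with 2 has an address value greater than \<open>\<rho>\<close>
  (\<open>greedy_top_address\<close> and \<open>top_addresses_eq\<close>). Since the largest continuation of a finite word is by
  letters 2, whose address value is 1, a finite word is not banned iff \<open>f\<^sub>v(1) > \<rho>\<close> for each of its
  subwords \<open>v\<close> starting with 2 (\<open>not_banned_imp_admissible\<close> and
  \<open>admissible_append_twos_top_address\<close>); such words are called admissible below.

  A reduced banned word \<open>\<alpha>\<close> with \<open>f\<^sub>\<alpha>(1) = \<rho>\<close> must start with 2 and end with 1, say \<open>\<alpha> = \<beta>1\<close>,
  and \<open>f\<^sub>1(1) = \<rho>\<close> then says that \<open>\<rho>\<close> is the fixed point of \<open>f\<^sub>\<beta>\<close>. This self-similarity at the
  critical point makes admissibility a local condition (\<open>admissible_if_locally_admissible\<close>): in a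
  word starting with 2, the first \<open>|\<beta>|\<close> letters either decide the comparison with \<open>\<rho>\<close>, or they
  are \<open>\<beta>\<close> and the comparison passes to the rest of the word, which again starts with 2. So
  forbidding the banned words of length at most \<open>|\<alpha>|\<close> forbids all banned words, and a sequence
  all of whose prefixes are admissible is a limit of top addresses.
\<close>

section \<open>Word maps and addresses of tails\<close>

lemma word_map_less_iff:
  assumes "0 < \<rho>"
  shows "word_map \<rho> w x < word_map \<rho> w y \<longleftrightarrow> x < y"
  using word_map_diff[of \<rho> w y x] assms
  by (metis diff_gt_0_iff_gt zero_less_mult_iff zero_less_power less_not_sym)

lemma word_map_le_iff:
  assumes "0 < \<rho>"
  shows "word_map \<rho> w x \<le> word_map \<rho> w y \<longleftrightarrow> x \<le> y"
  using word_map_less_iff[OF assms, of w y x] by linarith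

lemma word_map_unit_interval:
  assumes "0 < \<rho>" "\<rho> < 1" "x \<in> {0..1}"
  shows "word_map \<rho> w x \<in> {0..1}"
proof (induction w)
  case (Cons a w)
  define t where "t = \<rho> * word_map \<rho> w x"
  have "0 \<le> t" "t \<le> \<rho>"
    using Cons assms by (auto simp: t_def intro: mult_left_le)
  then show ?case using assms by (simp add: ifs_map_def t_def[symmetric])
qed (use assms in simp)

lemma word_map_append_one_le:
  assumes "0 < \<rho>" "\<rho> < 1"
  shows "word_map \<rho> (v @ w) 1 \<le> word_map \<rho> v 1"
  using word_map_unit_interval[OF assms, of 1 w] word_map_le_iff[OF assms(1)]
  by (simp add: word_map_append)

definition seq_tail :: "nat \<Rightarrow> (nat \<Rightarrow> nat) \<Rightarrow> nat \<Rightarrow> nat" where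
  "seq_tail k \<sigma> = (\<lambda>i. \<sigma> (k + i))"

lemma map_seq_tail: "map (seq_tail k \<sigma>) [0..<n] = map \<sigma> [k..<k + n]"
  by (rule nth_equalityI) (simp_all add: seq_tail_def)

lemma seq_tail_full_shift: "\<sigma> \<in> full_shift \<Longrightarrow> seq_tail k \<sigma> \<in> full_shift"
  by (simp add: seq_tail_def full_shift_def)

lemma seq_tail_seq_tail: "seq_tail j (seq_tail k \<sigma>) = seq_tail (k + j) \<sigma>"
  by (simp add: seq_tail_def add.assoc)

lemma address_map_unit_interval:
  assumes "0 < \<rho>" "\<rho> < 1"
  shows "address_map \<rho> \<sigma> \<in> {0..1}"
proof -
  have "word_map \<rho> (map \<sigma> [0..<k]) 0 \<in> {0..1}" for k
    using word_map_unit_interval[OF assms] by simp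
  then show ?thesis
    using closed_sequentially[OF closed_atLeastAtMost _ address_map_tendsto[OF assms]] by blast
qed

lemma address_map_seq_tail:
  assumes "0 < \<rho>" "\<rho> < 1"
  shows "address_map \<rho> \<sigma> = word_map \<rho> (map \<sigma> [0..<k]) (address_map \<rho> (seq_tail k \<sigma>))"
proof (rule LIMSEQ_unique)
  show "(\<lambda>n. word_map \<rho> (map \<sigma> [0..<n + k]) 0) \<longlonglongrightarrow> address_map \<rho> \<sigma>"
    using LIMSEQ_ignore_initial_segment[OF address_map_tendsto[OF assms]] .
  let ?P = "word_map \<rho> (map \<sigma> [0..<k])"
  have affine: "?P y = ?P 0 + \<rho> ^ k * y" for y
    using word_map_diff[of \<rho> "map \<sigma> [0..<k]" y 0] by simp
  have split: "map \<sigma> [0..<n + k] = map \<sigma> [0..<k] @ map (seq_tail k \<sigma>) [0..<n]" for n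
    unfolding map_seq_tail using upt_add_eq_append[of 0 k n]
    by (simp add: add.commute)
  have "word_map \<rho> (map \<sigma> [0..<n + k]) 0
      = ?P 0 + \<rho> ^ k * word_map \<rho> (map (seq_tail k \<sigma>) [0..<n]) 0" for n
    by (simp only: split word_map_append affine[symmetric])
  moreover have "(\<lambda>n. ?P 0 + \<rho> ^ k * word_map \<rho> (map (seq_tail k \<sigma>) [0..<n]) 0)
      \<longlonglongrightarrow> ?P (address_map \<rho> (seq_tail k \<sigma>))"
    by (subst affine[of "address_map _ _"]) (intro tendsto_intros address_map_tendsto[OF assms])
  ultimately show "(\<lambda>n. word_map \<rho> (map \<sigma> [0..<n + k]) 0)
      \<longlonglongrightarrow> ?P (address_map \<rho> (seq_tail k \<sigma>))"
    by simp
qed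

section \<open>Top addresses are the greedy sequences\<close>

definition greedy :: "real \<Rightarrow> (nat \<Rightarrow> nat) \<Rightarrow> bool" where
  "greedy \<rho> \<sigma> \<longleftrightarrow>
     \<sigma> \<in> full_shift \<and> (\<forall>k. \<sigma> k = 2 \<longrightarrow> \<rho> < address_map \<rho> (seq_tail k \<sigma>))"

text \<open>
  At the first position where another address of the same point differs from \<open>\<sigma>\<close>, both tails have
  the same address value \<open>y\<close>. An address with first letter 1 has value at most \<open>\<rho>\<close>, so if the
  letter of \<open>\<sigma>\<close> were 2, then \<open>y > \<rho>\<close> would rule out the letter 1 in the other address.
\<close>
lemma greedy_less_fun:
  assumes \<rho>: "0 < \<rho>" "\<rho> < 1"
    and \<sigma>: "greedy \<rho> \<sigma>" and \<upsilon>: "\<upsilon> \<in> full_shift" "address_map \<rho> \<upsilon> = address_map \<rho> \<sigma>" "\<sigma> \<noteq> \<upsilon>"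
  shows "less_fun \<sigma> \<upsilon>"
proof -
  define k where "k = (LEAST k. \<sigma> k \<noteq> \<upsilon> k)"
  have "\<exists>k. \<sigma> k \<noteq> \<upsilon> k" using \<upsilon>(3) by auto
  then have diff: "\<sigma> k \<noteq> \<upsilon> k" unfolding k_def by (rule LeastI_ex)
  have same: "\<sigma> i = \<upsilon> i" if "i < k" for i
    using not_less_Least that unfolding k_def by blast
  have prefix: "map \<sigma> [0..<k] = map \<upsilon> [0..<k]" by (simp add: same)
  have letters: "\<sigma> k \<in> {1, 2}" "\<upsilon> k \<in> {1, 2}"
    using \<sigma> \<upsilon>(1) by (auto simp: greedy_def full_shift_def)
  have "\<not> (\<sigma> k = 2 \<and> \<upsilon> k = 1)"
  proof
    assume *: "\<sigma> k = 2 \<and> \<upsilon> k = 1"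
    have "word_map \<rho> (map \<upsilon> [0..<k]) (address_map \<rho> (seq_tail k \<sigma>))
        = word_map \<rho> (map \<upsilon> [0..<k]) (address_map \<rho> (seq_tail k \<upsilon>))"
      using \<upsilon>(2) address_map_seq_tail[OF \<rho>, of \<sigma> k] address_map_seq_tail[OF \<rho>, of \<upsilon> k] prefix
      by simp
    then have "address_map \<rho> (seq_tail k \<sigma>) = address_map \<rho> (seq_tail k \<upsilon>)"
      using word_map_le_iff[OF \<rho>(1)] by (metis order.antisym order.refl)
    also have "\<dots> = \<rho> * address_map \<rho> (seq_tail (k + 1) \<upsilon>)"
      using * address_map_seq_tail[OF \<rho>, of "seq_tail k \<upsilon>" 1]
      by (simp add: seq_tail_seq_tail) (simp add: seq_tail_def ifs_map_def)
    also have "\<dots> \<le> \<rho>"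
      using address_map_unit_interval[OF \<rho>, of "seq_tail (k + 1) \<upsilon>"] \<rho> by (simp add: mult_left_le)
    finally show False using \<sigma> * by (force simp: greedy_def)
  qed
  then have "\<sigma> k < \<upsilon> k" using letters diff by auto
  then show ?thesis using same by (auto simp: less_fun_def)
qed

lemma greedy_top_address:
  assumes \<rho>: "0 < \<rho>" "\<rho> < 1" and \<sigma>: "greedy \<rho> \<sigma>"
  shows "top_address \<rho> (address_map \<rho> \<sigma>) = \<sigma>"
  unfolding top_address_def
proof (rule the_equality)
  show "\<sigma> \<in> full_shift \<and> address_map \<rho> \<sigma> = address_map \<rho> \<sigma> \<and>
    (\<forall>\<upsilon>\<in>full_shift. address_map \<rho> \<upsilon> = address_map \<rho> \<sigma> \<longrightarrow> \<sigma> = \<upsilon> \<or> less_fun \<sigma> \<upsilon>)"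
    using \<sigma> greedy_less_fun[OF \<rho> \<sigma>] by (auto simp: greedy_def)
next
  fix \<upsilon>
  assume \<upsilon>: "\<upsilon> \<in> full_shift \<and> address_map \<rho> \<upsilon> = address_map \<rho> \<sigma> \<and>
    (\<forall>\<phi>\<in>full_shift. address_map \<rho> \<phi> = address_map \<rho> \<sigma> \<longrightarrow> \<upsilon> = \<phi> \<or> less_fun \<upsilon> \<phi>)"
  then have "\<upsilon> = \<sigma> \<or> less_fun \<upsilon> \<sigma>" using \<sigma> by (auto simp: greedy_def)
  moreover have "\<sigma> = \<upsilon> \<or> less_fun \<sigma> \<upsilon>" using \<upsilon> greedy_less_fun[OF \<rho> \<sigma>] by auto
  ultimately show "\<upsilon> = \<sigma>" using less_fun_asym by blast
qed

text \<open>
  The greedy sequence is the itinerary of \<open>x\<close> under the map that inverts \<open>f\<^sub>1\<close> on \<open>[0, \<rho>]\<close> and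
  \<open>f\<^sub>2\<close> on \<open>(\<rho>, 1]\<close>. Since \<open>\<rho> > 1/2\<close>, the second interval lies in the image \<open>[1 - \<rho>, 1]\<close> of \<open>f\<^sub>2\<close>,
  which keeps the orbit inside \<open>[0, 1]\<close>.
\<close>
lemma greedy_exists:
  assumes \<rho>: "1 / 2 < \<rho>" "\<rho> < 1" and x: "x \<in> {0..1}"
  shows "\<exists>\<sigma>. greedy \<rho> \<sigma> \<and> address_map \<rho> \<sigma> = x"
proof -
  have \<rho>0: "0 < \<rho>" using \<rho> by simp
  define T where "T y = (if y \<le> \<rho> then y / \<rho> else (y - (1 - \<rho>)) / \<rho>)" for y
  define digit :: "real \<Rightarrow> nat" where "digit y = (if y \<le> \<rho> then 1 else 2)" for y
  define y where "y k = (T ^^ k) x" for k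
  define \<sigma> where "\<sigma> k = digit (y k)" for k
  have T01: "T z \<in> {0..1}" if "z \<in> {0..1}" for z
    using that \<rho> by (auto simp: T_def field_simps)
  have y01: "y k \<in> {0..1}" for k
    by (induction k) (use x T01 in \<open>auto simp: y_def simp del: atLeastAtMost_iff\<close>)
  have step: "ifs_map \<rho> (\<sigma> k) (y (Suc k)) = y k" for k
    using \<rho> by (auto simp: ifs_map_def \<sigma>_def digit_def y_def T_def field_simps)
  have orbit: "word_map \<rho> (map \<sigma> [k..<k + n]) (y (k + n)) = y k" for k n
    by (induction n) (simp_all add: word_map_append step)
  have tail_value: "address_map \<rho> (seq_tail k \<sigma>) = y k" for k
  proof (rule LIMSEQ_unique)
    let ?g = "\<lambda>n. word_map \<rho> (map (seq_tail k \<sigma>) [0..<n])"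
    show "(\<lambda>n. ?g n 0) \<longlonglongrightarrow> address_map \<rho> (seq_tail k \<sigma>)"
      by (rule address_map_tendsto[OF \<rho>0 \<rho>(2)])
    have "(\<lambda>n. \<rho> ^ n * y (k + n)) \<longlonglongrightarrow> 0"
    proof (rule tendsto_sandwich[OF _ _ tendsto_const])
      show "(\<lambda>n. \<rho> ^ n) \<longlonglongrightarrow> 0" using \<rho>0 \<rho> by (intro LIMSEQ_realpow_zero) auto
    qed (use \<rho>0 y01 in \<open>auto intro!: always_eventually mult_left_le\<close>)
    then have "(\<lambda>n. y k - \<rho> ^ n * y (k + n)) \<longlonglongrightarrow> y k - 0"
      by (intro tendsto_intros)
    moreover have "?g n 0 = y k - \<rho> ^ n * y (k + n)" for n
      using word_map_diff[of \<rho> "map \<sigma> [k..<k + n]" "y (k + n)" 0] orbit[of k n]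
      by (simp add: map_seq_tail)
    ultimately show "(\<lambda>n. ?g n 0) \<longlonglongrightarrow> y k" by simp
  qed
  have "greedy \<rho> \<sigma>"
    by (auto simp: greedy_def full_shift_def tail_value) (auto simp: \<sigma>_def digit_def split: if_splits)
  moreover have "address_map \<rho> \<sigma> = x"
    using tail_value[of 0] by (simp add: seq_tail_def y_def)
  ultimately show ?thesis by blast
qed

lemma top_addresses_eq:
  assumes "1 / 2 < \<rho>" "\<rho> < 1"
  shows "top_addresses \<rho> = {\<sigma>. greedy \<rho> \<sigma>}"
proof -
  have \<rho>: "0 < \<rho>" using assms by simp
  show ?thesis
    using greedy_exists[OF assms] greedy_top_address[OF \<rho> assms(2)]
      address_map_unit_interval[OF \<rho> assms(2)]
    unfolding top_addresses_def by (fastforce simp del: atLeastAtMost_iff intro: image_eqI[OF sym])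
qed

section \<open>The closure and its words\<close>

lemma seq_topology_closure_of_iff:
  assumes A: "A \<subseteq> full_shift"
  shows "\<sigma> \<in> seq_topology closure_of A \<longleftrightarrow>
    \<sigma> \<in> full_shift \<and> (\<forall>k. \<exists>\<upsilon>\<in>A. \<forall>i<k. \<upsilon> i = \<sigma> i)"
proof (intro iffI conjI allI)
  assume \<sigma>: "\<sigma> \<in> seq_topology closure_of A"
  then show full: "\<sigma> \<in> full_shift"
    by (simp add: in_closure_of topspace_seq_topology)
  fix k
  define U where "U = (\<Pi>\<^sub>E i\<in>UNIV. if i < k then {\<sigma> i} else {1, 2})"
  have "openin seq_topology U"
    unfolding seq_topology_def U_def
  proof (subst openin_PiE_gen, intro disjI2 conjI ballI)
    show "finite {i \<in> UNIV. (if i < k then {\<sigma> i} else {1, 2}) \<noteq> topspace (discrete_topology {1, 2})}"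
      by (rule finite_subset[of _ "{..<k}"]) auto
  qed (use full in \<open>auto simp: full_shift_def\<close>)
  moreover have "\<sigma> \<in> U" using full by (auto simp: U_def full_shift_def)
  ultimately obtain \<upsilon> where "\<upsilon> \<in> A" "\<upsilon> \<in> U"
    using \<sigma> by (auto simp: in_closure_of)
  then show "\<exists>\<upsilon>\<in>A. \<forall>i<k. \<upsilon> i = \<sigma> i"
    by (intro bexI[of _ \<upsilon>]) (auto simp: U_def PiE_iff split: if_splits)
next
  assume \<sigma>: "\<sigma> \<in> full_shift \<and> (\<forall>k. \<exists>\<upsilon>\<in>A. \<forall>i<k. \<upsilon> i = \<sigma> i)"
  show "\<sigma> \<in> seq_topology closure_of A"
    unfolding in_closure_of topspace_seq_topology
  proof (intro conjI allI impI)
    fix U assume "\<sigma> \<in> U \<and> openin seq_topology U"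
    then obtain V where V: "finite {i. V i \<noteq> {1, 2}}" "\<sigma> \<in> Pi\<^sub>E UNIV V" "Pi\<^sub>E UNIV V \<subseteq> U"
      unfolding seq_topology_def openin_product_topology_alt by auto
    from V(1)[unfolded finite_nat_set_iff_bounded]
    obtain k where k: "\<And>i. V i \<noteq> {1, 2} \<Longrightarrow> i < k" by blast
    obtain \<upsilon> where \<upsilon>: "\<upsilon> \<in> A" "\<forall>i<k. \<upsilon> i = \<sigma> i" using \<sigma> by blast
    have "\<upsilon> i \<in> V i" for i
      using k[of i] \<upsilon> A V(2) by (cases "i < k") (auto simp: PiE_iff full_shift_def)
    then have "\<upsilon> \<in> U" using V(3) by (auto simp: PiE_iff)
    then show "\<exists>y. y \<in> A \<and> y \<in> U" using \<upsilon>(1) by blast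
  qed (use \<sigma> in simp)
qed

lemma sublist_prefix_occurs_in:
  assumes "sublist v (map \<sigma> [0..<n])"
  shows "occurs_in v \<sigma>"
proof -
  obtain ps ss where split: "map \<sigma> [0..<n] = ps @ v @ ss" using assms by (auto simp: sublist_def)
  have len: "n = length ps + (length v + length ss)" using arg_cong[OF split, of length] by simp
  have "\<sigma> (length ps + i) = v ! i" if "i < length v" for i
    using arg_cong[OF split, of "\<lambda>l. l ! (length ps + i)"] that len by (simp add: nth_append)
  then have "map \<sigma> [length ps..<length ps + length v] = v" by (auto intro: nth_equalityI)
  then show ?thesis unfolding occurs_in_def by blast
qed

text \<open>The value of \<open>f\<^sub>v\<close> at 1 is the address value of \<open>v\<close> followed by letters 2 only.\<close>
definition admissible :: "real \<Rightarrow> nat list \<Rightarrow> bool" where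
  "admissible \<rho> w \<longleftrightarrow> (\<forall>v. sublist (2 # v) w \<longrightarrow> \<rho> < word_map \<rho> (2 # v) 1)"

text \<open>
  A word that occurs in the closure occurs in a greedy sequence, and replacing the part of a greedy
  sequence after the word by letters 2 can only increase the address values of tails.
\<close>
lemma not_banned_imp_admissible:
  assumes \<rho>: "1 / 2 < \<rho>" "\<rho> < 1" and w: "w \<in> words" "\<not> banned \<rho> w"
  shows "admissible \<rho> w"
  unfolding admissible_def
proof (intro allI impI)
  have \<rho>0: "0 < \<rho>" using \<rho> by simp
  fix v assume "sublist (2 # v) w"
  then obtain ps ss where split: "w = ps @ (2 # v) @ ss" by (auto simp: sublist_def)
  obtain \<sigma> k where \<sigma>: "\<sigma> \<in> top_closure \<rho>" "map \<sigma> [k..<k + length w] = w"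
    using w by (auto simp: banned_def occurs_in_def)
  moreover have "{\<sigma>. greedy \<rho> \<sigma>} \<subseteq> full_shift" by (auto simp: greedy_def)
  ultimately have "\<forall>n. \<exists>\<upsilon>. greedy \<rho> \<upsilon> \<and> (\<forall>i<n. \<upsilon> i = \<sigma> i)"
    by (simp add: top_closure_def top_addresses_eq[OF \<rho>] seq_topology_closure_of_iff)
  then obtain \<upsilon> where \<upsilon>: "greedy \<rho> \<upsilon>" "\<forall>i<k + length w. \<upsilon> i = \<sigma> i" by blast
  have letter: "\<upsilon> (k + i) = w ! i" if "i < length w" for i
  proof -
    have "\<sigma> (k + i) = map \<sigma> [k..<k + length w] ! i" using that by simp
    then show ?thesis using \<upsilon>(2) \<sigma>(2) that by simp
  qed
  let ?j = "k + length ps"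
  have "map (seq_tail ?j \<upsilon>) [0..<length (2 # v)] = 2 # v"
  proof (rule nth_equalityI)
    fix i assume "i < length (map (seq_tail ?j \<upsilon>) [0..<length (2 # v)])"
    then have i: "i < length (2 # v)" by simp
    then have "\<upsilon> (k + (length ps + i)) = w ! (length ps + i)"
      by (intro letter) (simp add: split)
    also have "\<dots> = (2 # v) ! i"
      using i unfolding split nth_append_length_plus by (simp add: nth_append del: append_Cons)
    finally show "map (seq_tail ?j \<upsilon>) [0..<length (2 # v)] ! i = (2 # v) ! i"
      using i by (simp add: seq_tail_def add.assoc del: upt_Suc)
  qed simp
  then have "address_map \<rho> (seq_tail ?j \<upsilon>)
      = word_map \<rho> (2 # v) (address_map \<rho> (seq_tail (length (2 # v)) (seq_tail ?j \<upsilon>)))"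
    using address_map_seq_tail[OF \<rho>0 \<rho>(2)] by metis
  also have "\<dots> \<le> word_map \<rho> (2 # v) 1"
    using address_map_unit_interval[OF \<rho>0 \<rho>(2)] unfolding word_map_le_iff[OF \<rho>0] by auto
  finally have "address_map \<rho> (seq_tail ?j \<upsilon>) \<le> word_map \<rho> (2 # v) 1" .
  moreover have "\<upsilon> ?j = 2" using letter[of "length ps"] by (simp add: split)
  ultimately show "\<rho> < word_map \<rho> (2 # v) 1" using \<upsilon>(1) by (force simp: greedy_def)
qed

lemma address_map_twos:
  assumes "0 < \<rho>" "\<rho> < 1"
  shows "address_map \<rho> (\<lambda>_. 2) = 1"
proof (rule LIMSEQ_unique)
  show "(\<lambda>k. word_map \<rho> (map (\<lambda>_. 2) [0..<k]) 1) \<longlonglongrightarrow> address_map \<rho> (\<lambda>_. 2)"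
    by (rule address_map_tendsto[OF assms])
  have "word_map \<rho> (map (\<lambda>_. 2) [0..<k]) 1 = 1" for k
    by (induction k) (simp_all add: word_map_append ifs_map_def)
  then show "(\<lambda>k. word_map \<rho> (map (\<lambda>_. 2) [0..<k]) 1) \<longlonglongrightarrow> 1" by simp
qed

lemma admissible_append_twos_top_address:
  assumes \<rho>: "1 / 2 < \<rho>" "\<rho> < 1" and w: "w \<in> words" "admissible \<rho> w"
  shows "(\<lambda>i. if i < length w then w ! i else 2) \<in> top_addresses \<rho>"
    (is "?\<sigma> \<in> _")
proof -
  have \<rho>0: "0 < \<rho>" using \<rho> by simp
  have tail: "address_map \<rho> (seq_tail k ?\<sigma>) = word_map \<rho> (drop k w) 1" for k
  proof -
    have "map (seq_tail k ?\<sigma>) [0..<length w - k] = drop k w"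
      by (rule nth_equalityI) (auto simp: seq_tail_def)
    moreover have "\<not> k + (length w - k + i) < length w" for i by arith
    then have "seq_tail (length w - k) (seq_tail k ?\<sigma>) = (\<lambda>_. 2)"
      by (simp add: seq_tail_def)
    ultimately show ?thesis
      using address_map_seq_tail[OF \<rho>0 \<rho>(2), of "seq_tail k ?\<sigma>" "length w - k"]
        address_map_twos[OF \<rho>0 \<rho>(2)] by simp
  qed
  have "\<rho> < address_map \<rho> (seq_tail k ?\<sigma>)" if "?\<sigma> k = 2" for k
  proof (cases "k < length w")
    case True
    then have "drop k w = 2 # drop (Suc k) w" using that by (simp add: Cons_nth_drop_Suc[symmetric])
    then show ?thesis
      using w(2) sublist_drop[of k w] unfolding tail admissible_def by metis
  qed (use tail \<rho> in simp)
  moreover have "?\<sigma> \<in> full_shift"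
  proof -
    have "w ! i \<in> {1, 2}" if "i < length w" for i
      using w(1) nth_mem[OF that] by (auto simp: words_def in_lists_conv_set)
    then show ?thesis by (auto simp: full_shift_def)
  qed
  ultimately show ?thesis by (simp add: top_addresses_eq[OF \<rho>] greedy_def)
qed

lemma top_addresses_subset_top_closure:
  assumes "1 / 2 < \<rho>" "\<rho> < 1"
  shows "top_addresses \<rho> \<subseteq> top_closure \<rho>"
  unfolding top_closure_def
  by (rule closure_of_subset) (auto simp: topspace_seq_topology top_addresses_eq[OF assms] greedy_def)

lemma banned_iff_not_admissible:
  assumes \<rho>: "1 / 2 < \<rho>" "\<rho> < 1" and w: "w \<in> words"
  shows "banned \<rho> w \<longleftrightarrow> \<not> admissible \<rho> w"
proof
  assume banned: "banned \<rho> w"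
  show "\<not> admissible \<rho> w"
  proof
    assume "admissible \<rho> w"
    let ?\<sigma> = "\<lambda>i. if i < length w then w ! i else 2"
    have "?\<sigma> \<in> top_closure \<rho>"
      using admissible_append_twos_top_address[OF \<rho> w \<open>admissible \<rho> w\<close>]
        top_addresses_subset_top_closure[OF \<rho>] by blast
    moreover have "occurs_in w ?\<sigma>"
      unfolding occurs_in_def by (rule exI[of _ 0]) (auto intro: nth_equalityI)
    ultimately show False using banned by (auto simp: banned_def)
  qed
qed (use not_banned_imp_admissible[OF \<rho> w] in blast)

section \<open>Admissibility is a local condition\<close>

text \<open>
  Minimality forces the given word to start with 2, as otherwise all its subwords starting with 2
  would be proper, and to end with 1, as a final 2 does not change the value at 1.
\<close>
lemma reduced_banned_critical_word:
  assumes \<rho>: "1 / 2 < \<rho>" "\<rho> < 1"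
    and red: "reduced_banned \<rho> \<alpha>" and val: "word_map \<rho> \<alpha> 1 = \<rho>"
  obtains \<gamma> where "\<alpha> = 2 # \<gamma> @ [1]" "word_map \<rho> (2 # \<gamma>) \<rho> = \<rho>"
    "\<And>v. strict_sublist (2 # v) \<alpha> \<Longrightarrow> \<rho> < word_map \<rho> (2 # v) 1"
proof -
  have words: "\<alpha> \<in> words" and banned: "banned \<rho> \<alpha>"
    using red by (auto simp: reduced_banned_def banned_def)
  have sub_words: "v \<in> words" if "sublist v \<alpha>" for v
    using that words by (auto simp: sublist_def words_def)
  have proper: "\<rho> < word_map \<rho> (2 # v) 1" if "strict_sublist (2 # v) \<alpha>" for v
  proof -
    have "\<not> banned \<rho> (2 # v)" using red that by (simp add: reduced_banned_def)
    moreover have "2 # v \<in> words" using that sub_words by (simp add: strict_sublist_def)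
    ultimately have "admissible \<rho> (2 # v)" by (simp add: banned_iff_not_admissible[OF \<rho>])
    then show ?thesis by (simp add: admissible_def)
  qed
  from banned words obtain v where v: "sublist (2 # v) \<alpha>" "\<not> \<rho> < word_map \<rho> (2 # v) 1"
    by (auto simp: banned_iff_not_admissible[OF \<rho>] admissible_def)
  then have \<alpha>: "\<alpha> = 2 # v"
    using proper by (metis strict_sublist_def sublist_order.order.not_eq_order_implies_strict)
  have "v \<noteq> []" using \<alpha> val \<rho> by (auto simp: ifs_map_def)
  then obtain \<gamma> a where v_split: "v = \<gamma> @ [a]" by (cases v rule: rev_cases) auto
  have a12: "a = 1 \<or> a = 2" using words by (auto simp: \<alpha> v_split words_def)
  have "a \<noteq> 2"
  proof
    assume "a = 2"
    then have "word_map \<rho> (2 # \<gamma>) 1 = \<rho>"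
      using val by (simp add: \<alpha> v_split word_map_append ifs_map_def)
    moreover have "strict_sublist (2 # \<gamma>) \<alpha>"
      unfolding \<alpha> v_split strict_sublist_def
      by (auto simp: sublist_def intro: exI[of _ "[]"])
    ultimately show False using proper by fastforce
  qed
  then have a: "a = 1" using a12 by simp
  show ?thesis
  proof (rule that)
    show "\<alpha> = 2 # \<gamma> @ [1]" by (simp add: \<alpha> v_split a)
    show "word_map \<rho> (2 # \<gamma>) \<rho> = \<rho>"
      using val by (simp add: \<alpha> v_split a word_map_append ifs_map_def)
  qed (rule proper)
qed

text \<open>
  By induction on the length of the subword \<open>2v\<close>. Its first \<open>|\<beta>|\<close> letters are compared with
  \<open>\<beta> = 2\<gamma>\<close>, where \<open>f\<^sub>1(1) = \<rho>\<close> and hence \<open>f\<^sub>\<beta>\<^sub>1(1) = f\<^sub>\<beta>(\<rho>) = \<rho>\<close>. If they are \<open>\<beta>\<close>, the next letter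
  is 2, as \<open>\<beta>1\<close> is not admissible; the induction hypothesis for the rest and \<open>f\<^sub>\<beta>(\<rho>) = \<rho>\<close> give the
  claim. Otherwise let \<open>q\<close> be the common prefix before the first difference. If the subword
  continues with 2 and \<open>\<beta>\<close> with 1, the induction hypothesis for the rest starting with this 2 gives
  a value greater than \<open>f\<^sub>q(\<rho>) = f\<^sub>q\<^sub>1(1) \<ge> f\<^sub>\<beta>\<^sub>1(1) = \<rho>\<close>. It cannot be the other way round: the
  tail of \<open>\<beta>1\<close> starting with this 2 has a value greater than \<open>\<rho>\<close> at 1, so that
  \<open>f\<^sub>q\<^sub>1(1) = f\<^sub>q(\<rho>) < f\<^sub>\<beta>\<^sub>1(1) = \<rho>\<close>, but \<open>q1\<close> is a short subword of \<open>2v\<close> and hence admissible.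
\<close>
lemma admissible_if_locally_admissible:
  assumes \<rho>: "0 < \<rho>" "\<rho> < 1"
    and \<gamma>: "\<gamma> \<in> words"
    and fixed: "word_map \<rho> (2 # \<gamma>) \<rho> = \<rho>"
    and proper: "\<And>v. strict_sublist (2 # v) (2 # \<gamma> @ [1]) \<Longrightarrow> \<rho> < word_map \<rho> (2 # v) 1"
    and w: "w \<in> words"
    and local: "\<And>v. sublist v w \<Longrightarrow> length v \<le> length \<gamma> + 2 \<Longrightarrow> admissible \<rho> v"
  shows "admissible \<rho> w"
proof -
  have "\<rho> < word_map \<rho> (2 # v) 1" if "sublist (2 # v) w" for v
    using that
  proof (induction "length v" arbitrary: v rule: less_induct)
    case less
    have short: "\<rho> < word_map \<rho> (2 # p) 1"
      if "sublist (2 # p) (2 # v)" "length (2 # p) \<le> length \<gamma> + 2" for p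
    proof -
      have "sublist (2 # p) w" using that(1) less.prems by (rule sublist_order.order.trans)
      then have "admissible \<rho> (2 # p)" using local that(2) by blast
      then show ?thesis by (simp add: admissible_def)
    qed
    show ?case
    proof (cases "length (2 # v) \<le> length \<gamma> + 2")
      case True
      then show ?thesis using short by simp
    next
      case False
      define u where "u = take (length \<gamma>) v"
      obtain c z where cz: "drop (length \<gamma>) v = c # z"
        using False by (cases "drop (length \<gamma>) v") auto
      have v: "v = u @ c # z" unfolding u_def cz[symmetric] by simp
      have len_u: "length u = length \<gamma>" using False by (simp add: u_def)
      have sub_w: "sublist s w" if "sublist s (2 # v)" for s
        using that less.prems by (rule sublist_order.order.trans)
      have letters: "x = 1 \<or> x = 2" if "x \<in> set v" for x
        using that w set_mono_sublist[OF less.prems] by (auto simp: words_def in_lists_conv_set)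
      show ?thesis
      proof (cases "u = \<gamma>")
        case True
        have "sublist (2 # \<gamma> @ [c]) (2 # v)"
          by (auto simp: v True sublist_def intro: exI[of _ "[]"])
        then have "\<rho> < word_map \<rho> (2 # \<gamma> @ [c]) 1" by (rule short) simp
        then have "c = 2"
          using fixed letters[of c] by (auto simp: v word_map_append ifs_map_def)
        have "sublist (2 # z) (2 # v)"
          by (auto simp: v \<open>c = 2\<close> sublist_def intro: exI[of _ "2 # u"])
        then have "\<rho> < word_map \<rho> (2 # z) 1"
          using less.hyps[of z] sub_w by (simp add: v)
        then have "word_map \<rho> (2 # \<gamma>) \<rho> < word_map \<rho> (2 # \<gamma>) (word_map \<rho> (2 # z) 1)"
          by (simp only: word_map_less_iff[OF \<rho>(1)])
        then show ?thesis
          using fixed by (simp add: v True \<open>c = 2\<close> word_map_append)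
      next
        case False
        then obtain p x u' y \<gamma>' where diff: "x \<noteq> y" "u = p @ [x] @ u'" "\<gamma> = p @ [y] @ \<gamma>'"
          using same_length_different[OF _ len_u] by blast
        have crit: "word_map \<rho> (2 # p) \<rho> = word_map \<rho> (2 # p @ [1]) 1"
          by (simp add: word_map_append ifs_map_def)
        have critical_value: "word_map \<rho> (2 # \<gamma> @ [1]) 1 = \<rho>"
          using fixed by (simp add: word_map_append ifs_map_def)
        have "x = 1 \<or> x = 2" using letters by (simp add: v diff(2))
        moreover have "y = 1 \<or> y = 2" using \<gamma> by (auto simp: diff(3) words_def)
        ultimately consider "x = 2" "y = 1" | "x = 1" "y = 2" using diff(1) by auto
        then show ?thesis
        proof cases
          case 1
          have "sublist (2 # u' @ c # z) (2 # v)"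
            by (auto simp: v diff(2) 1 sublist_def intro: exI[of _ "2 # p"])
          then have "\<rho> < word_map \<rho> (2 # u' @ c # z) 1"
            using less.hyps[of "u' @ c # z"] sub_w by (simp add: v diff(2))
          then have "word_map \<rho> (2 # p) \<rho> < word_map \<rho> (2 # p) (word_map \<rho> (2 # u' @ c # z) 1)"
            by (simp only: word_map_less_iff[OF \<rho>(1)])
          also have "\<dots> = word_map \<rho> (2 # v) 1"
            by (simp add: v diff(2) 1 word_map_append)
          finally have "word_map \<rho> (2 # p @ [1]) 1 < word_map \<rho> (2 # v) 1"
            by (simp only: crit)
          moreover have "word_map \<rho> (2 # \<gamma> @ [1]) 1 \<le> word_map \<rho> (2 # p @ [1]) 1"
            using word_map_append_one_le[OF \<rho>, of "2 # p @ [1]" "\<gamma>' @ [1]"]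
            by (simp add: diff(3) 1)
          ultimately show ?thesis using critical_value by linarith
        next
          case 2
          have "sublist (2 # p @ [1]) (2 # v)"
            by (auto simp: v diff(2) 2 sublist_def intro: exI[of _ "[]"])
          then have "\<rho> < word_map \<rho> (2 # p @ [1]) 1"
            by (rule short) (simp add: diff(3))
          moreover have "strict_sublist (2 # \<gamma>' @ [1]) (2 # \<gamma> @ [1])"
            by (auto simp: diff(3) 2 sublist_def strict_sublist_def intro: exI[of _ "2 # p"])
          then have "\<rho> < word_map \<rho> (2 # \<gamma>' @ [1]) 1" by (rule proper)
          then have "word_map \<rho> (2 # p) \<rho> < word_map \<rho> (2 # p) (word_map \<rho> (2 # \<gamma>' @ [1]) 1)"
            by (simp only: word_map_less_iff[OF \<rho>(1)])
          then have "word_map \<rho> (2 # p @ [1]) 1 < word_map \<rho> (2 # \<gamma> @ [1]) 1"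
            unfolding crit by (simp add: diff(3) 2 word_map_append)
          ultimately show ?thesis using critical_value by linarith
        qed
      qed
    qed
  qed
  then show ?thesis by (simp add: admissible_def)
qed

theorem corollary4p21:
  fixes \<rho> :: real
  assumes "1 / 2 < \<rho>" and "\<rho> < 1"
    and "\<exists>\<alpha>. reduced_banned \<rho> \<alpha> \<and> word_map \<rho> \<alpha> 1 = \<rho>"
  shows "ifs_of_finite_type \<rho>"
proof -
  note \<rho> = assms(1,2)
  have \<rho>0: "0 < \<rho>" using \<rho> by simp
  obtain \<alpha> where \<alpha>: "reduced_banned \<rho> \<alpha>" "word_map \<rho> \<alpha> 1 = \<rho>" using assms(3) by blast
  obtain \<gamma> where \<alpha>_eq: "\<alpha> = 2 # \<gamma> @ [1]" and fixed: "word_map \<rho> (2 # \<gamma>) \<rho> = \<rho>"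
    and proper: "\<And>v. strict_sublist (2 # v) \<alpha> \<Longrightarrow> \<rho> < word_map \<rho> (2 # v) 1"
    using reduced_banned_critical_word[OF \<rho> \<alpha>] by blast
  have \<gamma>: "\<gamma> \<in> words"
    using \<alpha>(1) by (auto simp: reduced_banned_def banned_def \<alpha>_eq words_def)
  define B where "B = {w. banned \<rho> w \<and> length w \<le> length \<gamma> + 2}"
  have "finite {w. set w \<subseteq> {1, 2 :: nat} \<and> length w \<le> length \<gamma> + 2}"
    by (rule finite_lists_length_le) simp
  then have "finite B"
    by (rule rev_finite_subset) (auto simp: B_def banned_def words_def)
  moreover have "B \<subseteq> words" by (auto simp: B_def banned_def)
  moreover have "top_closure \<rho> = {\<sigma> \<in> full_shift. \<forall>w\<in>B. \<not> occurs_in w \<sigma>}"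
  proof (intro set_eqI iffI)
    fix \<sigma> assume "\<sigma> \<in> top_closure \<rho>"
    moreover from this have "\<sigma> \<in> full_shift"
      by (simp add: top_closure_def in_closure_of topspace_seq_topology)
    ultimately show "\<sigma> \<in> {\<sigma> \<in> full_shift. \<forall>w\<in>B. \<not> occurs_in w \<sigma>}"
      by (auto simp: B_def banned_def)
  next
    fix \<sigma> assume "\<sigma> \<in> {\<sigma> \<in> full_shift. \<forall>w\<in>B. \<not> occurs_in w \<sigma>}"
    then have \<sigma>: "\<sigma> \<in> full_shift" "\<And>w. w \<in> B \<Longrightarrow> \<not> occurs_in w \<sigma>" by auto
    have "\<exists>\<upsilon>\<in>top_addresses \<rho>. \<forall>i<k. \<upsilon> i = \<sigma> i" for k
    proof -
      let ?w = "map \<sigma> [0..<k]"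
      have w: "?w \<in> words" using \<sigma>(1) by (auto simp: words_def full_shift_def in_lists_conv_set)
      have "admissible \<rho> ?w"
      proof (rule admissible_if_locally_admissible[OF \<rho>0 \<rho>(2) \<gamma> fixed proper[unfolded \<alpha>_eq] w])
        fix v assume v: "sublist v ?w" "length v \<le> length \<gamma> + 2"
        have "v \<in> words" using v(1) w by (auto simp: sublist_def words_def)
        moreover have "occurs_in v \<sigma>" using v(1) by (rule sublist_prefix_occurs_in)
        then have "\<not> banned \<rho> v" using \<sigma>(2) v(2) by (auto simp: B_def)
        ultimately show "admissible \<rho> v" by (simp add: banned_iff_not_admissible[OF \<rho>])
      qed
      from admissible_append_twos_top_address[OF \<rho> w this] show ?thesis
        by (rule bexI[rotated]) auto
    qed
    moreover have "top_addresses \<rho> \<subseteq> full_shift"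
      by (auto simp: top_addresses_eq[OF \<rho>] greedy_def)
    ultimately show "\<sigma> \<in> top_closure \<rho>"
      using \<sigma>(1) by (simp add: top_closure_def seq_topology_closure_of_iff)
  qed
  ultimately show ?thesis
    unfolding ifs_of_finite_type_def shift_of_finite_type_def by blast
qed

end
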